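(* Let $\alpha_i,\beta_i\in\mathbb S^1\setminus\Omega$, $i=1,2$, be parameters such that $\alpha_1\alpha_2=\beta_1\beta_2$ and consider the line $\ell:=\tau_{\alpha_1,\alpha_2}(\mathbb R)=\tau_{\beta_1,\beta_2}(\mathbb R)$ in $\mathbb C$. Then $\tau_1(t):=\tau_{\alpha_1,\alpha_2}(t)$ and $\tau_2(s):=\tau_{\beta_1,\beta_2}(s)$, $t,s\in\mathbb R$, parameterize $\ell$ in the same direction if and only if there exists $\delta\in\Omega$ satisfying $\delta\alpha_1\sim\beta_1$ and $\delta^{-1}\alpha_2\sim\beta_2$.
   Context: $\mathbb S^1\subset\mathbb C$ is the unit circle, $\omega=e^{2\pi i/3}$, $\Omega=\{1,\omega,\omega^2\}$. For $\alpha_1,\alpha_2\in\mathbb S^1\setminus\Omega$, the affine map $\tau_{\alpha_1,\alpha_2}:\mathbb R\to\mathbb C$ is $$\tau_{\alpha_1,\alpha_2}(t):=\alpha_1\alpha_2+\alpha_1^{-2}\alpha_2+\alpha_1\alpha_2^{-2}+(\alpha_1^{-2}-\alpha_1)(\alpha_2^{-2}-\alpha_2)t .$$ (When $\alpha_1\alpha_2=\beta_1\beta_2$, the real lines $\tau_{\alpha_1,\alpha_2}(\mathbb R)$ and $\tau_{\beta_1,\beta_2}(\mathbb R)$ coincide.) Two affine parameterizations of a line have the same direction if their (constant, nonzero) derivatives differ by a positive real factor. Put $I_0=\{e^{i\theta}:0<\theta<2\pi/3\}$, $I_1=\omega I_0$, $I_2=\omega^2I_0$; for $\alpha,\beta\in\mathbb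 S^1\setminus\Omega$, $\alpha\sim\beta$ means that $\alpha$ and $\beta$ lie in the same arc $I_j$. *)

theory Defs
  imports "HOL-Analysis.Analysis"
begin

definition omega :: complex where
  "omega = exp (2 * complex_of_real pi * \<i> / 3)"

definition Omega :: "complex set" where
  "Omega = {1, omega, omega ^ 2}"

definition tau :: "complex \<Rightarrow> complex \<Rightarrow> real \<Rightarrow> complex" where
  "tau \<alpha>1 \<alpha>2 t =
     \<alpha>1 * \<alpha>2 + \<alpha>1 powi (-2) * \<alpha>2 + \<alpha>1 * \<alpha>2 powi (-2)
     + (\<alpha>1 powi (-2) - \<alpha>1) * (\<alpha>2 powi (-2) - \<alpha>2) * complex_of_real t"

text \<open>Both parameterizations are required to have a constant derivative. Since \<open>u\<close> is
  nonzero and \<open>c\<close> is positive, the derivative \<open>v\<close> is nonzero as well.\<close>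

definition same_direction :: "(real \<Rightarrow> complex) \<Rightarrow> (real \<Rightarrow> complex) \<Rightarrow> bool" where
  "same_direction f g \<longleftrightarrow>
     (\<exists>u v c. u \<noteq> 0
        \<and> (\<forall>t. (f has_vector_derivative u) (at t))
        \<and> (\<forall>s. (g has_vector_derivative v) (at s))
        \<and> c > 0 \<and> v = c *\<^sub>R u)"

definition third_arc0 :: "complex set" where
  "third_arc0 = {exp (\<i> * complex_of_real \<theta>) | \<theta>. 0 < \<theta> \<and> \<theta> < 2 * pi / 3}"

definition third_arc :: "nat \<Rightarrow> complex set" where
  "third_arc j = (\<lambda>z. omega ^ j * z) ` third_arc0"

definition same_arc :: "complex \<Rightarrow> complex \<Rightarrow> bool" where
  "same_arc \<alpha> \<beta> \<longleftrightarrow> (\<exists>j\<in>{0, 1, 2}. \<alpha> \<in> third_arc j \<and> \<beta> \<in> third_arc j)"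

end

theory Submission
  imports Defs
begin

text \<open>Write \<open>\<alpha>\<^sub>k = \<omega>\<^bsup>p\<^sub>k\<^esup> e\<^bsup>i a\<^sub>k\<^esup>\<close> with \<open>0 < a\<^sub>k < 2\<pi>/3\<close>. Then \<open>\<alpha>\<^sub>k\<^bsup>-2\<^esup> - \<alpha>\<^sub>k\<close> is a positive
  multiple of \<open>-i \<omega>\<^bsup>p\<^sub>k\<^esup> e\<^bsup>-i a\<^sub>k/2\<^esup>\<close>, so the derivative of \<open>\<tau>\<close> is a positive multiple of the unit
  vector \<open>x = -\<omega>\<^bsup>p\<^sub>1+p\<^sub>2\<^esup> e\<^bsup>-i(a\<^sub>1+a\<^sub>2)/2\<^esup>\<close>, whose square is \<open>1/(\<alpha>\<^sub>1\<alpha>\<^sub>2)\<close>. Hence two parameterizations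
  with the same product have unit directions \<open>x = \<plusminus>y\<close>, and they pass through the same point at
  \<open>t = 1\<close>. Since \<open>\<bar>(a\<^sub>1+a\<^sub>2) - (b\<^sub>1+b\<^sub>2)\<bar> < 4\<pi>/3\<close>, the sign is \<open>+\<close> exactly when
  \<open>p\<^sub>1+p\<^sub>2\<close> and \<open>q\<^sub>1+q\<^sub>2\<close> agree modulo 3, which is the arc condition.\<close>

section \<open>Powers of \<open>omega\<close> and polar forms on the three arcs\<close>

lemma omega_eq_cis: "omega = cis (2 * pi / 3)"
  by (simp add: omega_def cis_conv_exp mult_ac)

lemma omega_pow_eq_cis: "omega ^ p = cis (2 * pi / 3 * real p)"
  by (simp add: omega_eq_cis Complex.DeMoivre mult_ac)

lemma omega_nonzero [simp]: "omega \<noteq> 0"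
  by (simp add: omega_def)

lemma omega_cubed: "omega ^ 3 = 1"
  by (simp add: omega_pow_eq_cis)

lemma omega_pow_mod: "omega ^ (p mod 3) = omega ^ p"
proof -
  have "omega ^ p = omega ^ (3 * (p div 3) + p mod 3)"
    by simp
  also have "\<dots> = omega ^ (p mod 3)"
    unfolding power_add power_mult omega_cubed by simp
  finally show ?thesis by simp
qed

lemma cis_eq_cis_near:
  assumes "cis x = cis y" "\<bar>x - y\<bar> < 2 * pi"
  shows "x = y"
proof -
  have "sin x = sin y \<and> cos x = cos y"
    using assms(1) by (auto simp: complex_eq_iff)
  then obtain n where n: "x = y + 2 * pi * of_int n"
    unfolding sin_cos_eq_iff by (auto simp: mult_ac)
  then have "2 * pi * \<bar>of_int n\<bar> < 2 * pi * (1::real)"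
    using assms(2) by (simp add: abs_mult)
  then have "\<bar>of_int n\<bar> < (1::real)"
    by simp
  then have "n = 0" by linarith
  then show ?thesis using n by simp
qed

text \<open>With exponents reduced modulo 3, both total angles lie strictly between 0 and 2 pi, so
  they coincide. Since \<open>a\<close> and \<open>b\<close> differ by less than 2 pi / 3, the
  reduced exponents differ by less than 1.\<close>

lemma omega_cis_eq_imp_mod_eq:
  assumes "omega ^ p * cis a = omega ^ q * cis b"
    and "0 < a" "a < 2 * pi / 3" "0 < b" "b < 2 * pi / 3"
  shows "p mod 3 = q mod 3"
proof -
  define m n where "m = p mod 3" and "n = q mod 3"
  have bounds: "m \<le> 2" "n \<le> 2"
    unfolding m_def n_def by presburger+
  have "omega ^ m * cis a = omega ^ n * cis b"
    using assms(1) by (simp add: m_def n_def omega_pow_mod)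
  then have "cis (2 * pi / 3 * real m + a) = cis (2 * pi / 3 * real n + b)"
    by (simp only: omega_pow_eq_cis cis_mult)
  moreover have le: "2 * pi / 3 * real m \<le> 4 * pi / 3" "2 * pi / 3 * real n \<le> 4 * pi / 3"
    using bounds mult_left_mono[of "real m" 2 "2 * pi / 3"]
      mult_left_mono[of "real n" 2 "2 * pi / 3"] by auto
  moreover have "0 \<le> 2 * pi / 3 * real m" "0 \<le> 2 * pi / 3 * real n"
    by simp_all
  ultimately have "2 * pi / 3 * real m + a = 2 * pi / 3 * real n + b"
    using assms(2-) by (intro cis_eq_cis_near) linarith+
  then have "2 * pi / 3 * (real m - real n) = b - a"
    unfolding right_diff_distrib by linarith
  then have "2 * pi / 3 * \<bar>real m - real n\<bar> = \<bar>b - a\<bar>"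
    by (simp add: abs_mult flip: \<open>_ = b - a\<close>)
  also have "\<dots> < 2 * pi / 3 * 1"
    using assms(2-) by linarith
  finally have "\<bar>real m - real n\<bar> < 1"
    by simp
  then have "m = n" by linarith
  then show ?thesis by (simp add: m_def n_def)
qed

lemma omega_pow_eq_iff: "omega ^ p = omega ^ q \<longleftrightarrow> p mod 3 = q mod 3"
proof
  assume "omega ^ p = omega ^ q"
  then show "p mod 3 = q mod 3"
    \<comment> \<open>Multiplying both powers by \<open>cis (pi / 3)\<close> moves them into the
      interiors of arcs; any common admissible angle would do.\<close>
    by (intro omega_cis_eq_imp_mod_eq[of p "pi / 3" q "pi / 3"]) auto
qed (metis omega_pow_mod)

lemma third_arc_iff: "z \<in> third_arc j \<longleftrightarrow> (\<exists>\<theta>. z = omega ^ j * cis \<theta> \<and> 0 < \<theta> \<and> \<theta> < 2 * pi / 3)"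
  by (auto simp: third_arc_def third_arc0_def cis_conv_exp)

text \<open>Exponents with different residues give disjoint arcs, so the arc relation becomes a
  congruence.\<close>

lemma same_arc_iff:
  assumes "0 < a" "a < 2 * pi / 3" "0 < b" "b < 2 * pi / 3"
  shows "same_arc (omega ^ p * cis a) (omega ^ q * cis b) \<longleftrightarrow> p mod 3 = q mod 3"
proof
  assume "same_arc (omega ^ p * cis a) (omega ^ q * cis b)"
  then obtain j where "omega ^ p * cis a \<in> third_arc j" "omega ^ q * cis b \<in> third_arc j"
    unfolding same_arc_def by blast
  then have "p mod 3 = j mod 3" "q mod 3 = j mod 3"
    unfolding third_arc_iff using omega_cis_eq_imp_mod_eq assms by blast+
  then show "p mod 3 = q mod 3" by simp
next
  assume eq: "p mod 3 = q mod 3"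
  have "p mod 3 \<in> {0, 1, 2}" by (simp; presburger)
  moreover have "omega ^ p * cis a \<in> third_arc (p mod 3)" "omega ^ q * cis b \<in> third_arc (p mod 3)"
    unfolding third_arc_iff using assms eq omega_pow_mod by metis+
  ultimately show "same_arc (omega ^ p * cis a) (omega ^ q * cis b)"
    unfolding same_arc_def by (intro bexI[of _ "p mod 3"] conjI)
qed

lemma sphere_minus_Omega_cases:
  assumes "z \<in> sphere 0 1 - Omega"
  obtains p a where "z = omega ^ p * cis a" "0 < a" "a < 2 * pi / 3"
proof -
  have "norm z = 1" using assms by simp
  then obtain t where t: "0 \<le> t" "t < 2 * pi" "z = cis t"
    using complex_unimodular_polar[of z] by (metis cis.code complex.expand complex.sel)
  have "cis t \<noteq> cis 0" "cis t \<noteq> cis (2 * pi / 3)" "cis t \<noteq> cis (4 * pi / 3)"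
    using assms unfolding Omega_def t(3) omega_eq_cis by (auto simp: Complex.DeMoivre)
  then have ne: "t \<noteq> 0" "t \<noteq> 2 * pi / 3" "t \<noteq> 4 * pi / 3"
    by blast+
  \<comment> \<open>\<open>p\<close> will be the number of complete thirds of a turn in
    \<open>t\<close>.\<close>
  have z: "z = omega ^ p * cis (t - 2 * pi / 3 * real p)" for p
    by (simp add: omega_pow_eq_cis cis_mult t(3))
  consider "t < 2 * pi / 3" | "2 * pi / 3 < t" "t < 4 * pi / 3" | "4 * pi / 3 < t"
    using ne by linarith
  then show thesis
  proof cases
    case 1
    then show thesis using that[OF z[of 0]] t ne by simp
  next
    case 2
    then show thesis using that[OF z[of 1]] by simp
  next
    case 3
    then show thesis using that[OF z[of 2]] t by simp
  qed
qed

lemma powi_minus_two_minus_self: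
  assumes "z = omega ^ p * cis a"
  shows "z powi (-2) - z = of_real (2 * sin (3 * a / 2)) * (- \<i> * (omega ^ p * cis (- a / 2)))"
proof -
  \<comment> \<open>A cube root of unity equals its own inverse square, so \<open>omega ^ p\<close>
    factors out of the difference.\<close>
  have "inverse (omega ^ p) ^ 2 = omega ^ p"
  proof -
    have "(omega ^ p) ^ 3 = 1"
      by (metis omega_cubed power_mult mult.commute power_one)
    then show ?thesis
      by (simp add: field_simps power2_eq_square power3_eq_cube)
  qed
  then have "z powi (-2) - z = omega ^ p * (cis (- 2 * a) - cis a)"
    by (simp add: assms right_diff_distrib power_int_minus power_mult_distrib Complex.DeMoivre
        flip: power_inverse)
  moreover have "cis (- 2 * a) - cis a = of_real (2 * sin (3 * a / 2)) * (- \<i> * cis (- a / 2))"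
  proof -
    \<comment> \<open>The angle \<open>- a / 2\<close> is the midpoint of \<open>- 2 * a\<close> and
      \<open>a\<close>; what remains is a difference of conjugates, hence purely imaginary.\<close>
    have "cis (- 2 * a) = cis (- (3 * a / 2)) * cis (- a / 2)"
      "cis a = cis (3 * a / 2) * cis (- a / 2)"
      by (simp_all add: cis_mult)
    moreover have "cis (- (3 * a / 2)) - cis (3 * a / 2) = of_real (2 * sin (3 * a / 2)) * (- \<i>)"
      by (simp add: complex_eq_iff)
    ultimately show ?thesis
      by (metis left_diff_distrib mult.assoc)
  qed
  ultimately show ?thesis
    by (simp add: mult_ac)
qed

section \<open>The derivative of \<open>tau\<close> and the common line\<close>

definition tau_deriv :: "complex \<Rightarrow> complex \<Rightarrow> complex" where
  "tau_deriv \<alpha>1 \<alpha>2 = (\<alpha>1 powi (-2) - \<alpha>1) * (\<alpha>2 powi (-2) - \<alpha>2)"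

text \<open>The basepoint \<open>t = 1\<close> is chosen because the value there depends on the product only.\<close>

lemma tau_eq:
  "tau \<alpha>1 \<alpha>2 t = 2 * (\<alpha>1 * \<alpha>2) + (\<alpha>1 * \<alpha>2) powi (-2) + of_real (t - 1) * tau_deriv \<alpha>1 \<alpha>2"
  by (simp add: tau_def tau_deriv_def power_int_mult_distrib algebra_simps)

lemma tau_has_vector_derivative:
  "(tau \<alpha>1 \<alpha>2 has_vector_derivative tau_deriv \<alpha>1 \<alpha>2) (at t)"
proof -
  have "((\<lambda>t. 2 * (\<alpha>1 * \<alpha>2) + (\<alpha>1 * \<alpha>2) powi (-2) + (t - 1) *\<^sub>R tau_deriv \<alpha>1 \<alpha>2)
      has_vector_derivative tau_deriv \<alpha>1 \<alpha>2) (at t)"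
    by (auto intro!: derivative_eq_intros)
  then show ?thesis
    by (simp add: tau_eq[abs_def] scaleR_conv_of_real)
qed

text \<open>Uniqueness of derivatives pins the existential \<open>u\<close> and \<open>v\<close> in
  \<open>same_direction\<close> to \<open>tau_deriv\<close>.\<close>

lemma same_direction_tau_iff:
  "same_direction (tau \<alpha>1 \<alpha>2) (tau \<beta>1 \<beta>2) \<longleftrightarrow>
    tau_deriv \<alpha>1 \<alpha>2 \<noteq> 0 \<and> (\<exists>c>0. tau_deriv \<beta>1 \<beta>2 = c *\<^sub>R tau_deriv \<alpha>1 \<alpha>2)"
  unfolding same_direction_def
  by (metis tau_has_vector_derivative vector_derivative_unique_at)

lemma range_tau_subset:
  assumes "\<alpha>1 * \<alpha>2 = \<beta>1 * \<beta>2" "tau_deriv \<alpha>1 \<alpha>2 = of_real k * tau_deriv \<beta>1 \<beta>2"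
  shows "range (tau \<alpha>1 \<alpha>2) \<subseteq> range (tau \<beta>1 \<beta>2)"
proof
  fix z assume "z \<in> range (tau \<alpha>1 \<alpha>2)"
  then obtain t where "z = tau \<alpha>1 \<alpha>2 t" by blast
  \<comment> \<open>Both lines share their point at parameter 1, so only the distance from 1 is
    rescaled.\<close>
  then have "z = tau \<beta>1 \<beta>2 (1 + (t - 1) * k)"
    by (simp add: tau_eq assms)
  then show "z \<in> range (tau \<beta>1 \<beta>2)" by blast
qed

lemma tau_deriv_polar:
  assumes "\<alpha>1 = omega ^ p1 * cis a1" "0 < a1" "a1 < 2 * pi / 3"
    and "\<alpha>2 = omega ^ p2 * cis a2" "0 < a2" "a2 < 2 * pi / 3"
  obtains r where "r > 0"
    "tau_deriv \<alpha>1 \<alpha>2 = of_real r * - (omega ^ (p1 + p2) * cis (- (a1 + a2) / 2))"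
proof
  \<comment> \<open>Both arguments lie strictly between 0 and pi. The minus sign in the conclusion
    is the product of the two factors \<open>- \<i>\<close>.\<close>
  have "sin (3 * a1 / 2) > 0" "sin (3 * a2 / 2) > 0"
    using assms by (auto intro!: sin_gt_zero)
  then show "2 * sin (3 * a1 / 2) * (2 * sin (3 * a2 / 2)) > 0"
    by simp
  have "cis (- (a1 + a2) / 2) = cis (- a1 / 2) * cis (- a2 / 2)"
    by (simp add: cis_mult diff_divide_distrib)
  then show "tau_deriv \<alpha>1 \<alpha>2 = of_real (2 * sin (3 * a1 / 2) * (2 * sin (3 * a2 / 2))) *
      - (omega ^ (p1 + p2) * cis (- (a1 + a2) / 2))"
    unfolding tau_deriv_def powi_minus_two_minus_self[OF assms(1)]
      powi_minus_two_minus_self[OF assms(4)]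
    by (simp add: power_add algebra_simps)
qed

section \<open>The sign between half-angle directions, and rotations of arcs\<close>

lemma half_direction_square:
  "(omega ^ p * cis (- A / 2)) ^ 2 = inverse (omega ^ p * cis A)"
proof -
  have "(omega ^ p) ^ 3 = 1"
    by (metis omega_cubed power_mult mult.commute power_one)
  then have "(omega ^ p) ^ 2 = inverse (omega ^ p)"
    by (simp add: field_simps power2_eq_square power3_eq_cube)
  then show ?thesis
    by (simp add: power_mult_distrib Complex.DeMoivre)
qed

text \<open>Equal half directions and equal products leave
  \<open>cis (3 * A / 2) = cis (3 * B / 2)\<close> as their quotient. The bound 4 pi / 3 is what
  keeps these angles less than 2 pi apart, forcing \<open>A = B\<close>.\<close>

lemma half_direction_eq_iff:
  assumes "omega ^ p * cis A = omega ^ q * cis B" "\<bar>A - B\<bar> < 4 * pi / 3"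
  shows "omega ^ p * cis (- A / 2) = omega ^ q * cis (- B / 2) \<longleftrightarrow> p mod 3 = q mod 3"
proof
  assume eq: "omega ^ p * cis (- A / 2) = omega ^ q * cis (- B / 2)"
  have split: "cis X = cis (3 * X / 2) * cis (- X / 2)" for X
    by (simp add: cis_mult)
  have "cis (3 * A / 2) * (omega ^ p * cis (- A / 2)) = omega ^ p * cis A"
    by (subst split[of A]) (simp add: mult_ac)
  also have "\<dots> = cis (3 * B / 2) * (omega ^ q * cis (- B / 2))"
    unfolding assms(1) by (subst split[of B]) (simp add: mult_ac)
  finally have "cis (3 * A / 2) = cis (3 * B / 2)"
    unfolding eq by simp
  moreover have "\<bar>3 * A / 2 - 3 * B / 2\<bar> < 2 * pi"
    using assms(2) by linarith
  ultimately have "A = B"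
    using cis_eq_cis_near by force
  then show "p mod 3 = q mod 3"
    using assms(1) by (simp add: omega_pow_eq_iff)
next
  assume "p mod 3 = q mod 3"
  then have pq: "omega ^ p = omega ^ q"
    by (simp add: omega_pow_eq_iff)
  then have "cis A = cis B"
    using assms(1) by simp
  moreover have "\<bar>A - B\<bar> < 2 * pi"
    using assms(2) pi_gt_zero by linarith
  ultimately show "omega ^ p * cis (- A / 2) = omega ^ q * cis (- B / 2)"
    using pq cis_eq_cis_near by metis
qed

text \<open>Rotating by \<open>omega ^ d\<close> and its inverse shifts the two exponents by d and
  -d modulo 3, which preserves their sum; matching the first arc determines d, and the sum then
  settles the second.\<close>

lemma rotation_same_arc_iff:
  assumes "0 < a1" "a1 < 2 * pi / 3" "0 < a2" "a2 < 2 * pi / 3"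
    and "0 < b1" "b1 < 2 * pi / 3" "0 < b2" "b2 < 2 * pi / 3"
  shows "(\<exists>\<delta>\<in>Omega. same_arc (\<delta> * (omega ^ p1 * cis a1)) (omega ^ q1 * cis b1)
            \<and> same_arc (inverse \<delta> * (omega ^ p2 * cis a2)) (omega ^ q2 * cis b2))
    \<longleftrightarrow> (p1 + p2) mod 3 = (q1 + q2) mod 3"
proof -
  have inv: "inverse (omega ^ d) = omega ^ (2 * d)" for d
  proof -
    have "omega ^ d * omega ^ (2 * d) = (omega ^ 3) ^ d"
      by (simp flip: power_add power_mult)
    then show ?thesis
      by (intro inverse_unique) (simp add: omega_cubed)
  qed
  have Omega: "Omega = (\<lambda>d. omega ^ d) ` {0, 1, 2}"
    by (simp add: Omega_def)
  have "(\<exists>\<delta>\<in>Omega. same_arc (\<delta> * (omega ^ p1 * cis a1)) (omega ^ q1 * cis b1)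
            \<and> same_arc (inverse \<delta> * (omega ^ p2 * cis a2)) (omega ^ q2 * cis b2))
    \<longleftrightarrow> (\<exists>d\<in>{0, 1, 2}. (d + p1) mod 3 = q1 mod 3 \<and> (2 * d + p2) mod 3 = q2 mod 3)"
    by (simp only: Omega bex_simps inv mult.assoc[symmetric] power_add[symmetric]
        same_arc_iff[OF assms(1,2,5,6)] same_arc_iff[OF assms(3,4,7,8)])
  also have "\<dots> \<longleftrightarrow> (p1 + p2) mod 3 = (q1 + q2) mod 3"
  proof
    assume "\<exists>d\<in>{0, 1, 2}. (d + p1) mod 3 = q1 mod 3 \<and> (2 * d + p2) mod 3 = q2 mod 3"
    then obtain d where "(d + p1) mod 3 = q1 mod 3" "(2 * d + p2) mod 3 = q2 mod 3"
      by blast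
    then have "((d + p1) + (2 * d + p2)) mod 3 = (q1 + q2) mod 3"
      by (rule mod_add_cong)
    also have "(d + p1) + (2 * d + p2) = (p1 + p2) + 3 * d"
      by simp
    finally show "(p1 + p2) mod 3 = (q1 + q2) mod 3"
      by simp
  next
    assume eq: "(p1 + p2) mod 3 = (q1 + q2) mod 3"
    \<comment> \<open>This is q1 - p1 modulo 3, with \<open>2 * p1\<close> standing for -p1 in the
      natural numbers.\<close>
    define d where "d = (q1 + 2 * p1) mod 3"
    have "d < 3"
      by (simp add: d_def)
    then have "d \<in> {0, 1, 2}"
      by auto
    moreover have "(d + p1) mod 3 = (q1 + 3 * p1) mod 3"
      unfolding d_def mod_add_left_eq by (simp add: add.assoc)
    moreover have "(2 * d + p2) mod 3 = (2 * (q1 + 2 * p1) + p2) mod 3"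
      unfolding d_def by (metis mod_add_left_eq mod_mult_right_eq)
    moreover have "2 * (q1 + 2 * p1) + p2 = (p1 + p2) + (2 * q1 + 3 * p1)"
      by simp
    moreover have "((p1 + p2) + (2 * q1 + 3 * p1)) mod 3 = ((q1 + q2) + (2 * q1 + 3 * p1)) mod 3"
      using eq by (rule mod_add_cong) simp
    moreover have "(q1 + q2) + (2 * q1 + 3 * p1) = q2 + 3 * (q1 + p1)"
      by simp
    ultimately show "\<exists>d\<in>{0, 1, 2}. (d + p1) mod 3 = q1 mod 3 \<and> (2 * d + p2) mod 3 = q2 mod 3"
      by (metis mod_mult_self2)
  qed
  finally show ?thesis .
qed

section \<open>Comparison of unit directions and the equivalence\<close>

lemma pos_multiple_unit_iff:
  fixes x y :: complex
  assumes "norm x = 1" "norm y = 1" "r > 0" "s > 0"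
  shows "(\<exists>c>0. of_real s * y = c *\<^sub>R (of_real r * x)) \<longleftrightarrow> x = y"
proof
  assume "\<exists>c>0. of_real s * y = c *\<^sub>R (of_real r * x)"
  then obtain c where c: "c > 0" "of_real s * y = of_real (c * r) * x"
    by (auto simp: scaleR_conv_of_real)
  then have "norm (of_real s * y) = norm (of_real (c * r) * x)" by simp
  then have "s = c * r"
    using assms c(1) by (simp add: norm_mult)
  then show "x = y"
    using c assms by simp
next
  assume "x = y"
  then have "of_real s * y = (s / r) *\<^sub>R (of_real r * x)"
    using assms by (simp add: scaleR_conv_of_real)
  then show "\<exists>c>0. of_real s * y = c *\<^sub>R (of_real r * x)"
    using assms by (metis divide_pos_pos)
qed

theorem proposition6p20:
  fixes \<alpha>1 \<alpha>2 \<beta>1 \<beta>2 :: complex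
  assumes "\<alpha>1 \<in> sphere 0 1 - Omega" and "\<alpha>2 \<in> sphere 0 1 - Omega"
    and "\<beta>1 \<in> sphere 0 1 - Omega" and "\<beta>2 \<in> sphere 0 1 - Omega"
    and "\<alpha>1 * \<alpha>2 = \<beta>1 * \<beta>2"
  shows "range (tau \<alpha>1 \<alpha>2) = range (tau \<beta>1 \<beta>2) \<and>
    (same_direction (tau \<alpha>1 \<alpha>2) (tau \<beta>1 \<beta>2) \<longleftrightarrow>
      (\<exists>\<delta>\<in>Omega. same_arc (\<delta> * \<alpha>1) \<beta>1 \<and> same_arc (inverse \<delta> * \<alpha>2) \<beta>2))"
proof -
  obtain p1 a1 where a1: "\<alpha>1 = omega ^ p1 * cis a1" "0 < a1" "a1 < 2 * pi / 3"
    using sphere_minus_Omega_cases[OF assms(1)] .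
  obtain p2 a2 where a2: "\<alpha>2 = omega ^ p2 * cis a2" "0 < a2" "a2 < 2 * pi / 3"
    using sphere_minus_Omega_cases[OF assms(2)] .
  obtain q1 b1 where b1: "\<beta>1 = omega ^ q1 * cis b1" "0 < b1" "b1 < 2 * pi / 3"
    using sphere_minus_Omega_cases[OF assms(3)] .
  obtain q2 b2 where b2: "\<beta>2 = omega ^ q2 * cis b2" "0 < b2" "b2 < 2 * pi / 3"
    using sphere_minus_Omega_cases[OF assms(4)] .
  define x where "x = - (omega ^ (p1 + p2) * cis (- (a1 + a2) / 2))"
  define y where "y = - (omega ^ (q1 + q2) * cis (- (b1 + b2) / 2))"
  obtain r where r: "r > 0" "tau_deriv \<alpha>1 \<alpha>2 = of_real r * x"
    using tau_deriv_polar[OF a1 a2] unfolding x_def .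
  obtain s where s: "s > 0" "tau_deriv \<beta>1 \<beta>2 = of_real s * y"
    using tau_deriv_polar[OF b1 b2] unfolding y_def .
  have unit: "norm x = 1" "norm y = 1"
    by (simp_all add: x_def y_def norm_mult norm_power omega_eq_cis)
  have prod: "omega ^ (p1 + p2) * cis (a1 + a2) = omega ^ (q1 + q2) * cis (b1 + b2)"
    using assms(5) unfolding a1 a2 b1 b2 by (simp add: power_add mult_ac flip: cis_mult)
  \<comment> \<open>Both squares are the inverse of the common product.\<close>
  then have "x ^ 2 = y ^ 2"
    by (simp only: x_def y_def power2_minus half_direction_square)
  then have "x = y \<or> x = - y"
    by (simp add: power2_eq_iff)
  \<comment> \<open>\<open>e\<close> is 1 or -1 according to the sign, so the same factor serves
    both ways.\<close>
  then obtain e :: real where e: "x = of_real e * y" "y = of_real e * x"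
    by (metis mult_1 mult_minus1 minus_minus of_real_1 of_real_minus)
  have "tau_deriv \<alpha>1 \<alpha>2 = of_real (r * e / s) * tau_deriv \<beta>1 \<beta>2"
    using r(2) s e(1) by simp
  moreover have "tau_deriv \<beta>1 \<beta>2 = of_real (s * e / r) * tau_deriv \<alpha>1 \<alpha>2"
    using s(2) r e(2) by simp
  ultimately have "range (tau \<alpha>1 \<alpha>2) = range (tau \<beta>1 \<beta>2)"
    using range_tau_subset assms(5) by (metis subset_antisym)
  moreover have "same_direction (tau \<alpha>1 \<alpha>2) (tau \<beta>1 \<beta>2) \<longleftrightarrow> x = y"
    unfolding same_direction_tau_iff r(2) s(2) pos_multiple_unit_iff[OF unit r(1) s(1)]
    using r(1) unit by auto
  moreover have "x = y \<longleftrightarrow> (p1 + p2) mod 3 = (q1 + q2) mod 3"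
    unfolding x_def y_def neg_equal_iff_equal
    \<comment> \<open>Both angle sums lie strictly between 0 and 4 pi / 3, which gives the required
      bound on their difference.\<close>
    using a1 a2 b1 b2 by (intro half_direction_eq_iff prod) linarith
  ultimately show ?thesis
    using rotation_same_arc_iff[OF a1(2,3) a2(2,3) b1(2,3) b2(2,3), of p1 q1 p2 q2]
    unfolding a1(1) a2(1) b1(1) b2(1) by blast
qed

end
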